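(* Let $q$ be a prime power, $n\ge0$ and $k\ge1$ integers. Let $P_{A,n}(k,q)$ be the probability that a uniformly random $\alpha\in A(n,q)$ has fixed space $\{v\in\mathbb{F}_q^{n+1}:\alpha v=v\}$ of dimension $k$, and $P_{A,\infty}(k,q)=\lim_{n\to\infty}P_{A,n}(k,q)$. Then (1) \[ P_{A,n}(k,q)=\frac{1}{|A(k-1,q)|}\sum_{i=0}^{n-k+1}\frac{(-1)^i}{q^{ki}(q^i-1)\cdots(q-1)}; \] (2) \[ P_{A,\infty}(k,q)=\Bigl[\prod_{r=1}^\infty(1-q^{-r})\Bigr]\frac{(1/q)^{k^2-k}}{(1-1/q)^2\cdots(1-1/q^{k-1})^2(1-1/q^k)}. \]
   Context: $A(n,q)$ is the group of matrices $x\in GL(n+1,q)$ with $x_{11}=1$ and $x_{j1}=0$ for $j\ge2$, acting on $\mathbb{F}_q^{n+1}$; $|A(m,q)|=q^m|GL(m,q)|$. An empty sum is $0$ and the $i=0$ term equals $1$. *)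

theory Defs
  imports "HOL-Analysis.Analysis" "Jordan_Normal_Form.Matrix_Kernel"
begin

text \<open>The group A(n,q): invertible (n+1)x(n+1) matrices over the finite field 'a
  (with q = CARD('a)) whose first column is the first standard basis vector
  (indices are 0-based here).\<close>
definition A_grp :: "nat \<Rightarrow> ('a::{finite,field}) mat set" where
  "A_grp n = {x \<in> carrier_mat (n+1) (n+1). invertible_mat x \<and> x $$ (0,0) = 1 \<and>
                 (\<forall>j. 1 \<le> j \<and> j \<le> n \<longrightarrow> x $$ (j,0) = 0)}"

definition fixed_dim :: "('a::field) mat \<Rightarrow> nat" where
  "fixed_dim x = kernel_dim (x - 1\<^sub>m (dim_row x))"

definition P_A :: "('a::{finite,field}) itself \<Rightarrow> nat \<Rightarrow> nat \<Rightarrow> real" where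
  "P_A (_::'a itself) n k =
     real (card {x \<in> (A_grp n :: 'a mat set). fixed_dim x = k}) / real (card (A_grp n :: 'a mat set))"

end

theory Submission
  imports Defs "Berlekamp_Zassenhaus.Berlekamp_Type_Based"
begin

text \<open>Write \<open>e\<close> for the first unit vector, which every element of the group fixes, and call a list
  of vectors that is independent together with \<open>e\<close> a frame. An element with
  \<open>d\<close>-dimensional fixed space fixes \<open>(q^d - q) \<cdots> (q^d - q^j)\<close> frames of length \<open>j\<close>. For \<open>j \<le> n\<close>
  the group is transitive on these frames, so by Burnside's lemma this number has mean \<open>1\<close>. These
  moments determine the distribution of \<open>d\<close> through a triangular linear system, whose inverse is
  found by a telescoping sum. The limit then follows from an identity of Euler: the series
  \<open>F k = (\<Sum>i. (-1)^i / (q^(k i) (q^i - 1) \<cdots> (q - 1)))\<close> satisfies \<open>F k = (1 - q^-(k+1)) F (k+1)\<close>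
  and tends to \<open>1\<close>.\<close>

unbundle no vec_syntax

section \<open>Invertible matrices\<close>

lemma mult_mat_vec_unit_vec:
  fixes A :: "'a::comm_semiring_1 mat"
  assumes "A \<in> carrier_mat m n" "i < n"
  shows "A *\<^sub>v unit_vec n i = col A i"
  using assms by (intro eq_vecI) auto

lemma eq_mat_if_agree_on_vecs:
  fixes A B :: "'a::comm_semiring_1 mat"
  assumes A: "A \<in> carrier_mat m n" and B: "B \<in> carrier_mat m n"
    and eq: "\<And>v. v \<in> carrier_vec n \<Longrightarrow> A *\<^sub>v v = B *\<^sub>v v"
  shows "A = B"
proof (rule mat_col_eqI)
  fix i assume "i < dim_col B"
  with B have i: "i < n" by simp
  show "col A i = col B i"
    using eq[of "unit_vec n i"] mult_mat_vec_unit_vec[OF A i] mult_mat_vec_unit_vec[OF B i] by simp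
qed (use A B in auto)

lemma invertible_mat_inverse:
  fixes A :: "'a::field mat"
  assumes "A \<in> carrier_mat n n"
  shows "invertible_mat A \<longleftrightarrow> (\<exists>B \<in> carrier_mat n n. A * B = 1\<^sub>m n \<and> B * A = 1\<^sub>m n)"
proof
  assume "invertible_mat A"
  then obtain B where B: "inverts_mat A B" "inverts_mat B A"
    unfolding invertible_mat_def by auto
  from B(1) assms have 1: "A * B = 1\<^sub>m n" unfolding inverts_mat_def by auto
  from B(2) have 2: "B * A = 1\<^sub>m (dim_row B)" unfolding inverts_mat_def by auto
  have "dim_col B = n" using arg_cong[OF 1, of dim_col] by simp
  moreover have "dim_row B = n" using arg_cong[OF 2, of dim_col] assms by simp
  ultimately show "\<exists>B \<in> carrier_mat n n. A * B = 1\<^sub>m n \<and> B * A = 1\<^sub>m n"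
    using 1 2 by (intro bexI[of _ B]) auto
next
  assume "\<exists>B \<in> carrier_mat n n. A * B = 1\<^sub>m n \<and> B * A = 1\<^sub>m n"
  then show "invertible_mat A"
    using assms unfolding invertible_mat_def inverts_mat_def by auto
qed

lemma invertible_mat_inj_on:
  fixes A :: "'a::field mat"
  assumes A: "A \<in> carrier_mat n n" and inv: "invertible_mat A"
  shows "inj_on ((*\<^sub>v) A) (carrier_vec n)"
proof -
  from inv obtain B where B: "B \<in> carrier_mat n n" "B * A = 1\<^sub>m n"
    unfolding invertible_mat_inverse[OF A] by auto
  have "B *\<^sub>v (A *\<^sub>v v) = v" if "v \<in> carrier_vec n" for v
    using assoc_mult_mat_vec[OF B(1) A that] B(2) that by simp
  then show ?thesis by (metis inj_onI)
qed

text \<open>Preimages of the unit vectors, taken as columns, form a right inverse; for square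
  matrices over a field it is two-sided.\<close>

lemma surj_imp_invertible_mat:
  fixes A :: "'a::field mat"
  assumes A: "A \<in> carrier_mat n n" and surj: "carrier_vec n \<subseteq> (*\<^sub>v) A ` carrier_vec n"
  shows "invertible_mat A"
proof -
  have "\<forall>i<n. \<exists>w. w \<in> carrier_vec n \<and> A *\<^sub>v w = unit_vec n i"
    using surj unit_vec_carrier[of n] by (metis imageE subsetD)
  then obtain f where f: "\<And>i. i < n \<Longrightarrow> f i \<in> carrier_vec n" "\<And>i. i < n \<Longrightarrow> A *\<^sub>v f i = unit_vec n i"
    by metis
  define B where "B = mat_of_cols n (map f [0..<n])"
  have B: "B \<in> carrier_mat n n" unfolding B_def by auto
  have colB: "col B i = f i" if "i < n" for i
    using that f(1) unfolding B_def by (subst col_mat_of_cols) auto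
  have "A * B = 1\<^sub>m n"
  proof (rule mat_col_eqI)
    fix i assume "i < dim_col (1\<^sub>m n :: 'a mat)"
    then have i: "i < n" by simp
    then show "col (A * B) i = col (1\<^sub>m n) i"
      using col_mult2[OF A B i] colB[OF i] f(2)[OF i] by simp
  qed (use A B in auto)
  with mat_mult_left_right_inverse[OF A B] B show ?thesis
    unfolding invertible_mat_inverse[OF A] by auto
qed

lemma invertible_mat_mult:
  fixes A B :: "'a::field mat"
  assumes A: "A \<in> carrier_mat n n" "invertible_mat A" and B: "B \<in> carrier_mat n n" "invertible_mat B"
  shows "invertible_mat (A * B)"
proof -
  have AB: "A * B \<in> carrier_mat n n" using A B by auto
  obtain A' where A': "A' \<in> carrier_mat n n" "A * A' = 1\<^sub>m n" "A' * A = 1\<^sub>m n"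
    using A invertible_mat_inverse by blast
  obtain B' where B': "B' \<in> carrier_mat n n" "B * B' = 1\<^sub>m n" "B' * B = 1\<^sub>m n"
    using B invertible_mat_inverse by blast
  have "(A * B) * (B' * A') = A * ((B * B') * A')"
    using A(1) B(1) A'(1) B'(1)
    by (simp add: assoc_mult_mat[of _ n n _ n _ n])
  also have "\<dots> = 1\<^sub>m n" using A' B' by simp
  finally have 1: "(A * B) * (B' * A') = 1\<^sub>m n" .
  moreover have C: "B' * A' \<in> carrier_mat n n" using A' B' by auto
  ultimately show ?thesis
    using mat_mult_left_right_inverse[OF AB C] unfolding invertible_mat_inverse[OF AB] by blast
qed

section \<open>Independent lists of vectors over a finite field\<close>

definition vec_subspace :: "nat \<Rightarrow> 'a::field vec set \<Rightarrow> bool" where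
  "vec_subspace n W \<longleftrightarrow> W \<subseteq> carrier_vec n \<and> 0\<^sub>v n \<in> W \<and>
     (\<forall>v\<in>W. \<forall>w\<in>W. v + w \<in> W) \<and> (\<forall>a. \<forall>v\<in>W. a \<cdot>\<^sub>v v \<in> W)"

fun list_span :: "nat \<Rightarrow> 'a::field vec list \<Rightarrow> 'a vec set" where
  "list_span n [] = {0\<^sub>v n}"
| "list_span n (v # vs) = (\<lambda>(a, w). a \<cdot>\<^sub>v v + w) ` (UNIV \<times> list_span n vs)"

text \<open>Each vector is tested against the span of those after it, so a fixed tail
  \<open>vs\<close> is prolonged at the head to \<open>us @ vs\<close>. For this reason the fixed
  unit vector stands at the end of a frame.\<close>

fun list_indep :: "nat \<Rightarrow> 'a::field vec list \<Rightarrow> bool" where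
  "list_indep n [] \<longleftrightarrow> True"
| "list_indep n (v # vs) \<longleftrightarrow> list_indep n vs \<and> v \<in> carrier_vec n \<and> v \<notin> list_span n vs"

lemma list_span_ConsI: "w \<in> list_span n vs \<Longrightarrow> a \<cdot>\<^sub>v v + w \<in> list_span n (v # vs)"
  by auto

lemma list_indep_carrier: "list_indep n vs \<Longrightarrow> set vs \<subseteq> carrier_vec n"
  by (induction vs) auto

lemma vec_subspace_carrier: "vec_subspace n (carrier_vec n)"
  by (auto simp: vec_subspace_def)

lemma vec_subspace_list_span:
  assumes "set vs \<subseteq> carrier_vec n"
  shows "vec_subspace n (list_span n vs)"
  using assms
proof (induction vs)
  case Nil
  then show ?case by (auto simp: vec_subspace_def)
next
  case (Cons v vs)
  then have v: "v \<in> carrier_vec n" and IH: "vec_subspace n (list_span n vs)" by auto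
  have sub: "\<And>w. w \<in> list_span n vs \<Longrightarrow> w \<in> carrier_vec n"
    and zero: "0\<^sub>v n \<in> list_span n vs"
    and add: "\<And>w w'. w \<in> list_span n vs \<Longrightarrow> w' \<in> list_span n vs \<Longrightarrow> w + w' \<in> list_span n vs"
    and smult: "\<And>a w. w \<in> list_span n vs \<Longrightarrow> a \<cdot>\<^sub>v w \<in> list_span n vs"
    using IH by (auto simp: vec_subspace_def)
  have I: "x \<in> list_span n (v # vs)" if "x = a \<cdot>\<^sub>v v + w" "w \<in> list_span n vs" for x a w
    unfolding that(1) using that(2) by (rule list_span_ConsI)
  show ?case unfolding vec_subspace_def
  proof (intro conjI ballI allI)
    show "list_span n (v # vs) \<subseteq> carrier_vec n" using v sub by auto
    show "0\<^sub>v n \<in> list_span n (v # vs)"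
      using v zero by (intro I[of _ 0 "0\<^sub>v n"]) auto
    fix x assume "x \<in> list_span n (v # vs)"
    then obtain a w where x: "x = a \<cdot>\<^sub>v v + w" and w: "w \<in> list_span n vs" by auto
    {
      fix y assume "y \<in> list_span n (v # vs)"
      then obtain b w' where y: "y = b \<cdot>\<^sub>v v + w'" and w': "w' \<in> list_span n vs" by auto
      have "x + y = (a + b) \<cdot>\<^sub>v v + (w + w')"
        unfolding x y using v sub[OF w] sub[OF w'] by (intro eq_vecI) (auto simp: algebra_simps)
      then show "x + y \<in> list_span n (v # vs)" using add[OF w w'] by (rule I)
    }
    fix b
    have "b \<cdot>\<^sub>v x = (b * a) \<cdot>\<^sub>v v + b \<cdot>\<^sub>v w"
      unfolding x using v sub[OF w] by (intro eq_vecI) (auto simp: algebra_simps)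
    then show "b \<cdot>\<^sub>v x \<in> list_span n (v # vs)" using smult[OF w] by (rule I)
  qed
qed

lemma list_span_subset:
  assumes "vec_subspace n W" "set vs \<subseteq> W"
  shows "list_span n vs \<subseteq> W"
  using assms(2)
proof (induction vs)
  case (Cons v vs)
  then have "list_span n vs \<subseteq> W" "v \<in> W" by auto
  then show ?case using assms(1) unfolding vec_subspace_def by auto
qed (use assms(1) in \<open>simp add: vec_subspace_def\<close>)

text \<open>By induction, \<open>a \<cdot>\<^sub>v v + w\<close> determines \<open>(a, w)\<close>:
  two different coefficients would let one solve for \<open>v\<close> inside the span of the
  remaining vectors.\<close>

lemma card_list_span:
  fixes vs :: "'a::{finite,field} vec list"
  assumes "list_indep n vs"
  shows "card (list_span n vs) = CARD('a) ^ length vs"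
  using assms
proof (induction vs)
  case (Cons v vs)
  have v: "v \<in> carrier_vec n" "v \<notin> list_span n vs" using Cons.prems by auto
  have W: "vec_subspace n (list_span n vs)"
    using Cons.prems list_indep_carrier by (intro vec_subspace_list_span) auto
  have sub: "\<And>w. w \<in> list_span n vs \<Longrightarrow> w \<in> carrier_vec n"
    and add: "\<And>w w'. w \<in> list_span n vs \<Longrightarrow> w' \<in> list_span n vs \<Longrightarrow> w + w' \<in> list_span n vs"
    and smult: "\<And>a w. w \<in> list_span n vs \<Longrightarrow> a \<cdot>\<^sub>v w \<in> list_span n vs"
    using W by (auto simp: vec_subspace_def)
  have inj: "inj_on (\<lambda>(a, w). a \<cdot>\<^sub>v v + w) (UNIV \<times> list_span n vs)"
  proof (rule inj_onI, clarsimp)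
    fix a w b w'
    assume w: "w \<in> list_span n vs" and w': "w' \<in> list_span n vs"
      and eq: "a \<cdot>\<^sub>v v + w = b \<cdot>\<^sub>v v + w'"
    have eqi: "a * v $ i + w $ i = b * v $ i + w' $ i" if "i < n" for i
      using arg_cong[OF eq, of "\<lambda>x. x $ i"] that v sub[OF w] sub[OF w'] by auto
    have ab: "a = b"
    proof (rule ccontr)
      assume "a \<noteq> b"
      then have nz: "a - b \<noteq> 0" by simp
      \<comment> \<open>The difference is written with the scalar \<open>-1\<close> because the
        closure facts at hand concern sums and scalar multiples.\<close>
      have "v = inverse (a - b) \<cdot>\<^sub>v (w' + (-1) \<cdot>\<^sub>v w)"
      proof (rule eq_vecI)
        show "v $ i = (inverse (a - b) \<cdot>\<^sub>v (w' + (-1) \<cdot>\<^sub>v w)) $ i"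
          if "i < dim_vec (inverse (a - b) \<cdot>\<^sub>v (w' + (-1) \<cdot>\<^sub>v w))" for i
        proof -
          have i: "i < n" using that sub[OF w] by auto
          have "(a - b) * v $ i = w' $ i - w $ i" using eqi[OF i] by (simp add: algebra_simps)
          then have "v $ i = inverse (a - b) * (w' $ i - w $ i)"
            using nz by (simp add: field_simps)
          then show ?thesis using i sub[OF w] sub[OF w'] by simp
        qed
      qed (use v sub[OF w] in auto)
      then show False using v(2) smult[OF add[OF w' smult[OF w]]] by metis
    qed
    have "w = w'"
      using eqi ab sub[OF w] sub[OF w'] by (intro eq_vecI) auto
    with ab show "a = b \<and> w = w'" by simp
  qed
  show ?case using Cons by (simp add: card_image[OF inj] card_cartesian_product)
qed simp

lemma list_span_map_mult_mat_vec:
  fixes A :: "'a::field mat"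
  assumes A: "A \<in> carrier_mat m n" and "set vs \<subseteq> carrier_vec n"
  shows "list_span m (map ((*\<^sub>v) A) vs) = (*\<^sub>v) A ` list_span n vs"
  using assms(2)
proof (induction vs)
  case Nil
  then show ?case using A by auto
next
  case (Cons v vs)
  then have v: "v \<in> carrier_vec n" by simp
  have sub: "list_span n vs \<subseteq> carrier_vec n"
    using Cons.prems vec_subspace_list_span[of vs n] by (auto simp: vec_subspace_def)
  have *: "A *\<^sub>v (a \<cdot>\<^sub>v v + w) = a \<cdot>\<^sub>v (A *\<^sub>v v) + A *\<^sub>v w" if "w \<in> list_span n vs" for a w
    using that sub v mult_add_distrib_mat_vec[OF A, of "a \<cdot>\<^sub>v v" w] mult_mat_vec[OF A v, of a] by auto
  show ?case
  proof (intro equalityI subsetI)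
    fix x assume "x \<in> list_span m (map ((*\<^sub>v) A) (v # vs))"
    then obtain a w where "w \<in> list_span n vs" "x = a \<cdot>\<^sub>v (A *\<^sub>v v) + A *\<^sub>v w"
      using Cons by auto
    then show "x \<in> (*\<^sub>v) A ` list_span n (v # vs)"
      using *[of w a] by (intro image_eqI[OF _ list_span_ConsI[of w n vs a]]) auto
  next
    fix x assume "x \<in> (*\<^sub>v) A ` list_span n (v # vs)"
    then obtain a w where "w \<in> list_span n vs" "x = A *\<^sub>v (a \<cdot>\<^sub>v v + w)" by auto
    then show "x \<in> list_span m (map ((*\<^sub>v) A) (v # vs))"
      using * Cons.IH Cons.prems list_span_ConsI[of "A *\<^sub>v w" m "map ((*\<^sub>v) A) vs"] by simp
  qed
qed

lemma list_indep_map_mult_mat_vec: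
  fixes A :: "'a::field mat"
  assumes A: "A \<in> carrier_mat m n" and inj: "inj_on ((*\<^sub>v) A) (carrier_vec n)"
    and "list_indep n vs"
  shows "list_indep m (map ((*\<^sub>v) A) vs)"
  using assms(3)
proof (induction vs)
  case (Cons v vs)
  have vs: "set vs \<subseteq> carrier_vec n" using Cons.prems list_indep_carrier by auto
  then have "list_span n vs \<subseteq> carrier_vec n"
    using vec_subspace_list_span[of vs n] by (auto simp: vec_subspace_def)
  then have "A *\<^sub>v v \<notin> list_span m (map ((*\<^sub>v) A) vs)"
    using Cons.prems inj unfolding list_span_map_mult_mat_vec[OF A vs]
    by (simp add: inj_on_image_mem_iff)
  then show ?case using Cons A by auto
qed simp

section \<open>Counting independent lists in a subspace\<close>

lemma finite_vec_subspace:
  fixes W :: "'a::{finite,field} vec set"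
  shows "vec_subspace n W \<Longrightarrow> finite W"
  using finite_subset[OF _ finite_carrier_vec] unfolding vec_subspace_def by blast

text \<open>A new head may be any vector of \<open>W\<close> outside the span already built, which
  has \<open>q^i\<close> elements at length \<open>i\<close>. If \<open>m\<close> is too large, the
  factor \<open>i = d\<close> is zero, in accordance with the absence of such lists, so truncated
  subtraction does no harm.\<close>

lemma card_list_indep_extensions:
  fixes vs :: "'a::{finite,field} vec list"
  assumes W: "vec_subspace n W" "card W = CARD('a) ^ d"
    and vs: "list_indep n vs" "set vs \<subseteq> W"
  shows "card {us. length us = m \<and> set us \<subseteq> W \<and> list_indep n (us @ vs)} =
           (\<Prod>i = length vs..<length vs + m. CARD('a) ^ d - CARD('a) ^ i)"
proof (induction m)
  case 0
  have "{us. length us = 0 \<and> set us \<subseteq> W \<and> list_indep n (us @ vs)} = {[]}" using vs by auto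
  then show ?case by simp
next
  case (Suc m)
  let ?S = "\<lambda>m. {us. length us = m \<and> set us \<subseteq> W \<and> list_indep n (us @ vs)}"
  have finW: "finite W" using W(1) by (rule finite_vec_subspace)
  have WC: "W \<subseteq> carrier_vec n" using W(1) by (simp add: vec_subspace_def)
  have "?S m \<subseteq> {us. set us \<subseteq> W \<and> length us = m}" by auto
  then have fin: "finite (?S m)" using finite_lists_length_eq[OF finW] finite_subset by blast
  \<comment> \<open>The admissible heads depend on the tail, hence a dependent sum rather than a
    product.\<close>
  have eq: "?S (Suc m) = (\<lambda>(us, u). u # us) ` (SIGMA us:?S m. W - list_span n (us @ vs))"
  proof (intro equalityI subsetI)
    fix x assume x: "x \<in> ?S (Suc m)"
    then obtain u us where "x = u # us" by (cases x) auto
    with x show "x \<in> (\<lambda>(us, u). u # us) ` (SIGMA us:?S m. W - list_span n (us @ vs))"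
      by (intro image_eqI[of _ _ "(us, u)"]) auto
  next
    fix x assume "x \<in> (\<lambda>(us, u). u # us) ` (SIGMA us:?S m. W - list_span n (us @ vs))"
    then show "x \<in> ?S (Suc m)" using WC by auto
  qed
  have card1: "card (W - list_span n (us @ vs)) = CARD('a) ^ d - CARD('a) ^ (length vs + m)"
    if us: "us \<in> ?S m" for us
  proof -
    have "list_span n (us @ vs) \<subseteq> W" using us vs by (intro list_span_subset[OF W(1)]) auto
    then show ?thesis using us W(2) finite_subset[OF _ finW]
      by (simp add: card_Diff_subset card_list_span add.commute)
  qed
  have "card (?S (Suc m)) = card (SIGMA us:?S m. W - list_span n (us @ vs))"
    unfolding eq by (intro card_image) (auto simp: inj_on_def)
  also have "\<dots> = (\<Sum>us\<in>?S m. card (W - list_span n (us @ vs)))"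
    using fin finW by (intro card_SigmaI) auto
  also have "\<dots> = card (?S m) * (CARD('a) ^ d - CARD('a) ^ (length vs + m))"
    using card1 by simp
  finally show ?case unfolding Suc.IH by simp
qed

lemma one_less_CARD_field: "1 < CARD('a::{finite,field})"
proof -
  have "card {0::'a, 1} \<le> CARD('a)" by (intro card_mono) auto
  then show ?thesis by simp
qed

lemma list_indep_length_le:
  fixes vs :: "'a::{finite,field} vec list"
  assumes "list_indep n vs"
  shows "length vs \<le> n"
proof -
  have "list_span n vs \<subseteq> carrier_vec n"
    using list_span_subset[OF vec_subspace_carrier list_indep_carrier[OF assms]] .
  then have "CARD('a) ^ length vs \<le> CARD('a) ^ n"
    using card_mono[OF finite_carrier_vec, of "list_span n vs" n]
    by (simp only: card_list_span[OF assms] card_carrier_vec)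
  then show ?thesis by (rule power_le_imp_le_exp[OF one_less_CARD_field])
qed

lemma list_span_full:
  fixes vs :: "'a::{finite,field} vec list"
  assumes "list_indep n vs" "length vs = n"
  shows "list_span n vs = carrier_vec n"
proof (rule card_subset_eq[OF finite_carrier_vec])
  show "list_span n vs \<subseteq> carrier_vec n"
    by (rule list_span_subset[OF vec_subspace_carrier list_indep_carrier[OF assms(1)]])
  show "card (list_span n vs) = card (carrier_vec n :: 'a vec set)"
    by (simp only: card_list_span[OF assms(1)] card_carrier_vec assms(2))
qed

text \<open>Existence by counting: the number of completions is a product of nonzero factors
  \<open>q^n - q^i\<close> with \<open>i < n\<close>.\<close>

lemma list_indep_extend:
  fixes vs :: "'a::{finite,field} vec list"
  assumes vs: "list_indep n vs"
  obtains us where "list_indep n (us @ vs)" "length (us @ vs) = n"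
proof -
  have le: "length vs \<le> n" using vs by (rule list_indep_length_le)
  let ?S = "{us. length us = n - length vs \<and> set us \<subseteq> carrier_vec n \<and> list_indep n (us @ vs)}"
  have "card ?S = (\<Prod>i = length vs..<length vs + (n - length vs). CARD('a) ^ n - CARD('a) ^ i)"
    by (rule card_list_indep_extensions[OF vec_subspace_carrier card_carrier_vec vs list_indep_carrier[OF vs]])
  also have "\<dots> \<noteq> 0"
    using power_strict_increasing[OF _ one_less_CARD_field[where 'a='a], of _ n] le
    by (subst prod_zero_iff) (simp_all, fastforce)
  finally have "?S \<noteq> {}" by fastforce
  then obtain us where "us \<in> ?S" by blast
  then show ?thesis using le by (intro that[of us]) simp_all
qed

section \<open>Matrices acting on ordered bases\<close>

lemma mat_of_cols_mult_unit_vec: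
  fixes vs :: "'a::comm_semiring_1 vec list"
  assumes "set vs \<subseteq> carrier_vec n" "i < length vs"
  shows "mat_of_cols n vs *\<^sub>v unit_vec (length vs) i = vs ! i"
  using assms mult_mat_vec_unit_vec[of "mat_of_cols n vs" n "length vs" i]
  by (auto simp: col_mat_of_cols subset_iff)

lemma vec_subspace_image:
  assumes A: "A \<in> carrier_mat m n"
  shows "vec_subspace m ((*\<^sub>v) A ` carrier_vec n)"
  unfolding vec_subspace_def
proof (intro conjI ballI allI)
  show "(*\<^sub>v) A ` carrier_vec n \<subseteq> carrier_vec m" using A by auto
  show "0\<^sub>v m \<in> (*\<^sub>v) A ` carrier_vec n" using A by (intro image_eqI[of _ _ "0\<^sub>v n"]) auto
  fix v assume "v \<in> (*\<^sub>v) A ` carrier_vec n"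
  then obtain x where x: "x \<in> carrier_vec n" "v = A *\<^sub>v x" by auto
  show "a \<cdot>\<^sub>v v \<in> (*\<^sub>v) A ` carrier_vec n" for a
    using A x by (intro image_eqI[of _ _ "a \<cdot>\<^sub>v x"]) (auto simp: mult_mat_vec)
  fix w assume "w \<in> (*\<^sub>v) A ` carrier_vec n"
  then obtain y where y: "y \<in> carrier_vec n" "w = A *\<^sub>v y" by auto
  show "v + w \<in> (*\<^sub>v) A ` carrier_vec n"
    using A x y by (intro image_eqI[of _ _ "x + y"]) (auto simp: mult_add_distrib_mat_vec)
qed

text \<open>The image is a subspace containing the columns, hence their span, which is the whole
  space; surjectivity gives invertibility.\<close>

lemma invertible_mat_of_cols:
  fixes vs :: "'a::{finite,field} vec list"
  assumes "list_indep n vs" "length vs = n"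
  shows "invertible_mat (mat_of_cols n vs)"
proof (rule surj_imp_invertible_mat)
  let ?B = "mat_of_cols n vs"
  show B: "?B \<in> carrier_mat n n" using assms by auto
  have vs: "set vs \<subseteq> carrier_vec n" using assms(1) by (rule list_indep_carrier)
  have "set vs \<subseteq> (*\<^sub>v) ?B ` carrier_vec n"
  proof
    fix v assume "v \<in> set vs"
    then obtain i where "i < length vs" "v = vs ! i" by (auto simp: in_set_conv_nth)
    then show "v \<in> (*\<^sub>v) ?B ` carrier_vec n"
      using mat_of_cols_mult_unit_vec[OF vs, of i] assms(2)
      by (intro image_eqI[of _ _ "unit_vec n i"]) auto
  qed
  from list_span_subset[OF vec_subspace_image[OF B] this] list_span_full[OF assms]
  show "carrier_vec n \<subseteq> (*\<^sub>v) ?B ` carrier_vec n" by simp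
qed

text \<open>Transitivity on ordered bases: with the bases as columns of \<open>B\<close> and
  \<open>C\<close>, the matrix \<open>C B^-1\<close> carries one to the other.\<close>

lemma ex_invertible_mat_between_frames:
  fixes us vs :: "'a::{finite,field} vec list"
  assumes us: "list_indep n us" "length us = n" and vs: "list_indep n vs" "length vs = n"
  obtains A where "A \<in> carrier_mat n n" "invertible_mat A" "map ((*\<^sub>v) A) us = vs"
proof -
  let ?B = "mat_of_cols n us" and ?C = "mat_of_cols n vs"
  have B: "?B \<in> carrier_mat n n" "invertible_mat ?B" using us invertible_mat_of_cols by auto
  have C: "?C \<in> carrier_mat n n" "invertible_mat ?C" using vs invertible_mat_of_cols by auto
  obtain B' where B': "B' \<in> carrier_mat n n" "?B * B' = 1\<^sub>m n" "B' * ?B = 1\<^sub>m n"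
    using B invertible_mat_inverse by blast
  have invB': "invertible_mat B'" using B(1) B' invertible_mat_inverse by blast
  have "(?C * B') *\<^sub>v us ! i = vs ! i" if i: "i < n" for i
  proof -
    have [simp]: "us ! i \<in> carrier_vec n" using i us list_indep_carrier nth_mem by blast
    have "us ! i = ?B *\<^sub>v unit_vec n i"
      using mat_of_cols_mult_unit_vec[OF list_indep_carrier[OF us(1)], of i] us i by simp
    then have "B' *\<^sub>v us ! i = (B' * ?B) *\<^sub>v unit_vec n i"
      using assoc_mult_mat_vec[OF B'(1) B(1), of "unit_vec n i"] by simp
    also have "\<dots> = unit_vec n i" using B'(3) by simp
    finally have "(?C * B') *\<^sub>v us ! i = ?C *\<^sub>v unit_vec n i"
      using assoc_mult_mat_vec[OF C(1) B'(1)] by simp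
    then show ?thesis
      using mat_of_cols_mult_unit_vec[OF list_indep_carrier[OF vs(1)], of i] vs i by simp
  qed
  then have "map ((*\<^sub>v) (?C * B')) us = vs" using us vs by (intro nth_equalityI) auto
  moreover have "?C * B' \<in> carrier_mat n n" using C(1) B'(1) by auto
  moreover have "invertible_mat (?C * B')" using invertible_mat_mult[OF C B'(1) invB'] .
  ultimately show ?thesis using that by blast
qed

text \<open>The vectors on which \<open>A\<close> and \<open>B\<close> agree form a subspace, and it
  contains a basis.\<close>

lemma mat_eq_if_agree_on_frame:
  fixes us :: "'a::{finite,field} vec list"
  assumes us: "list_indep n us" "length us = n"
    and A: "A \<in> carrier_mat m n" and B: "B \<in> carrier_mat m n"
    and eq: "map ((*\<^sub>v) A) us = map ((*\<^sub>v) B) us"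
  shows "A = B"
proof (rule eq_mat_if_agree_on_vecs[OF A B])
  let ?W = "{v \<in> carrier_vec n. A *\<^sub>v v = B *\<^sub>v v}"
  have "vec_subspace n ?W" unfolding vec_subspace_def
    using A B by (auto simp: mult_add_distrib_mat_vec mult_mat_vec)
  moreover have "set us \<subseteq> ?W" using eq list_indep_carrier[OF us(1)] by auto
  ultimately have "carrier_vec n \<subseteq> ?W" using list_span_subset list_span_full[OF us] by metis
  then show "A *\<^sub>v v = B *\<^sub>v v" if "v \<in> carrier_vec n" for v using that by auto
qed

text \<open>Complete \<open>vs\<close> to a basis by \<open>ws\<close>. An element of
  \<open>G\<close> is determined by the images of \<open>ws\<close>, and these may be any vectors
  that again complete \<open>vs\<close>; so \<open>G\<close> is as large as the set of
  completions.\<close>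

lemma card_pointwise_stabilizer:
  fixes vs :: "'a::{finite,field} vec list"
  assumes vs: "list_indep n vs"
  defines "G \<equiv> {A \<in> carrier_mat n n. invertible_mat A \<and> (\<forall>v\<in>set vs. A *\<^sub>v v = v)}"
  shows "finite G" and "card G = (\<Prod>i = length vs..<n. CARD('a) ^ n - CARD('a) ^ i)"
proof -
  have le: "length vs \<le> n" using vs by (rule list_indep_length_le)
  let ?S = "{us. length us = n - length vs \<and> set us \<subseteq> carrier_vec n \<and> list_indep n (us @ vs)}"
  have "?S \<subseteq> {us. set us \<subseteq> carrier_vec n \<and> length us = n - length vs}" by auto
  then have finS: "finite ?S"
    using finite_lists_length_eq[OF finite_carrier_vec] finite_subset by blast
  obtain ws where ws: "list_indep n (ws @ vs)" "length (ws @ vs) = n"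
    using list_indep_extend[OF vs] .
  have fixvs: "map ((*\<^sub>v) A) vs = vs" if "A \<in> G" for A
    using that by (auto simp: G_def map_idI)
  have bij: "bij_betw (\<lambda>A. map ((*\<^sub>v) A) ws) G ?S"
  proof (rule bij_betwI')
    fix A B assume A: "A \<in> G" and B: "B \<in> G"
    then show "map ((*\<^sub>v) A) ws = map ((*\<^sub>v) B) ws \<longleftrightarrow> A = B"
      using mat_eq_if_agree_on_frame[OF ws, of A n B] fixvs[OF A] fixvs[OF B] by (auto simp: G_def)
  next
    fix A assume A: "A \<in> G"
    then have "list_indep n (map ((*\<^sub>v) A) (ws @ vs))"
      using ws by (intro list_indep_map_mult_mat_vec[OF _ invertible_mat_inj_on]) (auto simp: G_def)
    then have "list_indep n (map ((*\<^sub>v) A) ws @ vs)" using fixvs[OF A] by simp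
    moreover from list_indep_carrier[OF this] have "set (map ((*\<^sub>v) A) ws) \<subseteq> carrier_vec n"
      by simp
    moreover have "length (map ((*\<^sub>v) A) ws) = n - length vs" using ws(2) by simp
    ultimately show "map ((*\<^sub>v) A) ws \<in> ?S" by blast
  next
    \<comment> \<open>Surjectivity: the matrix carrying \<open>ws @ vs\<close> to
      \<open>us @ vs\<close> fixes \<open>vs\<close> pointwise, because both lists end in
      \<open>vs\<close>.\<close>
    fix us assume us: "us \<in> ?S"
    then obtain A where A: "A \<in> carrier_mat n n" "invertible_mat A" "map ((*\<^sub>v) A) (ws @ vs) = us @ vs"
      using ex_invertible_mat_between_frames[OF ws, of "us @ vs"] le by auto
    then have map_ws: "map ((*\<^sub>v) A) ws = us" and map_vs: "map ((*\<^sub>v) A) vs = vs"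
      using us ws(2) by auto
    have "A \<in> G"
      using A(1,2) map_vs map_eq_conv[of "(*\<^sub>v) A" vs id] unfolding G_def by simp
    with map_ws show "\<exists>A\<in>G. us = map ((*\<^sub>v) A) ws" by blast
  qed
  show "finite G" using bij_betw_finite[OF bij] finS by simp
  have "card G = card ?S" by (rule bij_betw_same_card[OF bij])
  also have "\<dots> = (\<Prod>i = length vs..<length vs + (n - length vs). CARD('a) ^ n - CARD('a) ^ i)"
    by (rule card_list_indep_extensions[OF vec_subspace_carrier card_carrier_vec vs list_indep_carrier[OF vs]])
  finally show "card G = (\<Prod>i = length vs..<n. CARD('a) ^ n - CARD('a) ^ i)" using le by simp
qed

section \<open>Cardinality of kernels\<close>

lemma vec_subspace_mat_kernel:
  assumes A: "A \<in> carrier_mat m n"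
  shows "vec_subspace n (mat_kernel A)"
  unfolding vec_subspace_def mat_kernel[OF A]
  using A by (auto simp: mult_add_distrib_mat_vec mult_mat_vec)

lemma card_mat_kernel:
  fixes A :: "'a::{finite,field} mat"
  assumes A: "A \<in> carrier_mat m n"
  shows "card (mat_kernel A) = CARD('a) ^ kernel_dim A"
proof -
  interpret kernel m n A by unfold_locales (rule A)
  obtain B where B: "finite B" "basis B" using kernel_basis_exists[OF A] by blast
  have BC: "B \<subseteq> mat_kernel A" using B(2) unfolding Ker.basis_def by auto
  have ex1: "\<exists>!a. a \<in> B \<rightarrow>\<^sub>E UNIV \<and> lincomb a B = v" if "v \<in> mat_kernel A" for v
    using Ker.basis_criterion[OF B(1) BC] B(2) that by auto
  \<comment> \<open>Coefficient functions are taken extensional on \<open>B\<close>, so that each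
    kernel vector has exactly one.\<close>
  have "bij_betw (\<lambda>a. lincomb a B) (B \<rightarrow>\<^sub>E UNIV) (mat_kernel A)"
  proof (rule bij_betw_imageI)
    have mem: "lincomb a B \<in> mat_kernel A" for a
      using Ker.lincomb_closed[OF BC] by auto
    show "inj_on (\<lambda>a. lincomb a B) (B \<rightarrow>\<^sub>E UNIV)"
      using ex1 mem by (intro inj_onI) metis
    show "(\<lambda>a. lincomb a B) ` (B \<rightarrow>\<^sub>E UNIV) = mat_kernel A"
      using ex1 mem by blast
  qed
  from bij_betw_same_card[OF this, symmetric]
  have "card (mat_kernel A) = CARD('a) ^ card B" using B(1) by (simp add: card_PiE)
  then show ?thesis using Ker.dim_basis[OF B] by simp
qed

section \<open>Inversion of the moments\<close>

lemma prod_power_minus_one_pos: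
  fixes x :: real
  assumes "x > 1"
  shows "(\<Prod>l=1..t. x ^ l - 1) > 0"
proof (rule prod_pos)
  fix l assume "l \<in> {1..t}"
  then show "0 < x ^ l - 1" using one_less_power[OF assms, of l] by simp
qed

text \<open>Induction on \<open>T\<close>. The closed form serves at \<open>Y = x ^ r\<close>: it is
  \<open>1\<close> for \<open>r = 0\<close> and zero for \<open>1 \<le> r \<le> T\<close>, where the
  factor \<open>i = r\<close> vanishes.\<close>

lemma sum_telescoped_q_falling:
  fixes x Y :: real
  assumes x: "x > 1"
  shows "(\<Sum>t\<le>T. (-1) ^ t * (\<Prod>i<t. Y - x ^ i) / (\<Prod>l=1..t. x ^ l - 1)) =
           (-1) ^ T * (\<Prod>i=1..T. Y - x ^ i) / (\<Prod>l=1..T. x ^ l - 1)"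
proof (induction T)
  case 0
  then show ?case by simp
next
  case (Suc T)
  let ?P = "\<Prod>i=1..T. Y - x ^ i" and ?D = "\<Prod>l=1..T. x ^ l - 1"
  have D: "?D \<noteq> 0" using prod_power_minus_one_pos[OF x, of T] by linarith
  have E: "x ^ Suc T - 1 \<noteq> 0" using one_less_power[OF x, of "Suc T"] by linarith
  \<comment> \<open>The exponents start at \<open>0\<close> on the left and at \<open>1\<close> on
    the right; splitting off \<open>Y - 1\<close> makes \<open>?P\<close> a common factor.\<close>
  have "(\<Prod>i<Suc T. Y - x ^ i) = (Y - 1) * (\<Prod>i<T. Y - x ^ Suc i)"
    by (simp add: prod.lessThan_Suc_shift del: power_Suc prod.lessThan_Suc)
  also have "(\<Prod>i<T. Y - x ^ Suc i) = ?P"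
    by (rule prod.reindex_bij_witness[of _ "\<lambda>i. i - 1" Suc]) auto
  finally have P: "(\<Prod>i<Suc T. Y - x ^ i) = (Y - 1) * ?P" .
  have P': "(\<Prod>i=1..Suc T. Y - x ^ i) = ?P * (Y - x ^ Suc T)"
    and D': "(\<Prod>l=1..Suc T. x ^ l - 1) = ?D * (x ^ Suc T - 1)"
    by (simp_all del: power_Suc)
  \<comment> \<open>Here \<open>s\<close> is the sign, \<open>p\<close> and \<open>d\<close> are
    \<open>?P\<close> and \<open>?D\<close>, and \<open>e\<close> is \<open>x ^ Suc T\<close>; the
    identity amounts to \<open>(e - 1) - (Y - 1) = e - Y\<close>.\<close>
  have step: "s * p / d + (- s) * ((Y - 1) * p) / (d * (e - 1)) = (- s) * (p * (Y - e)) / (d * (e - 1))"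
    if "d \<noteq> 0" "e - 1 \<noteq> 0" for s p d e :: real
  proof -
    have "s * p / d = s * p * (e - 1) / (d * (e - 1))" using that by simp
    moreover have "s * p * (e - 1) + (- s) * ((Y - 1) * p) = (- s) * (p * (Y - e))"
      by (simp add: algebra_simps)
    ultimately show ?thesis by (simp only: add_divide_distrib[symmetric])
  qed
  have sgn: "(-1) ^ Suc T = - ((-1) ^ T :: real)" by simp
  show ?case
    unfolding sum.atMost_Suc Suc.IH P P' D' sgn by (rule step[OF D E])
qed

text \<open>The coefficients invert the triangular matrix with entries
  \<open>\<Prod>i=1..j. (x^m - x^i)\<close>.\<close>

lemma q_inversion:
  fixes x :: real
  assumes x: "x > 1" and k: "k \<ge> 1" and m: "1 \<le> m" "m \<le> k + T"
  shows "(\<Sum>t\<le>T. (-1) ^ t / (x ^ (k * t) * (\<Prod>l=1..t. x ^ l - 1)) *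
            (\<Prod>i=1..<k + t. x ^ m - x ^ i)) =
         (if m = k then \<Prod>i=1..<k. x ^ k - x ^ i else 0)"
proof -
  \<comment> \<open>The first \<open>k - 1\<close> factors are independent of \<open>t\<close> and
    come out of the sum.\<close>
  have split: "(\<Prod>i=1..<k + t. x ^ m - x ^ i) =
      (\<Prod>i=1..<k. x ^ m - x ^ i) * (\<Prod>i<t. x ^ m - x ^ (k + i))" for t
  proof -
    have "(\<Prod>i=k..<k + t. x ^ m - x ^ i) = (\<Prod>i<t. x ^ m - x ^ (k + i))"
      by (rule prod.reindex_bij_witness[of _ "\<lambda>i. k + i" "\<lambda>i. i - k"]) auto
    then show ?thesis
      using prod.atLeastLessThan_concat[of 1 k "k + t" "\<lambda>i. x ^ m - x ^ i"] k by simp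
  qed
  show ?thesis
  proof (cases "m < k")
    case True
    \<comment> \<open>The common factor with \<open>i = m\<close> vanishes.\<close>
    then have "(\<Prod>i=1..<k. x ^ m - x ^ i) = 0" using m by (intro prod_zero) auto
    then show ?thesis using True by (simp only: split) simp
  next
    case False
    define r where "r = m - k"
    have m_eq: "m = k + r" using False by (simp add: r_def)
    \<comment> \<open>Taking \<open>x ^ k\<close> out of each factor cancels the power
      \<open>x ^ (k * t)\<close> in the coefficient and leaves the sum of
      \<open>sum_telescoped_q_falling\<close> at \<open>Y = x ^ r\<close>.\<close>
    have "(\<Prod>i<t. x ^ m - x ^ (k + i)) = x ^ (k * t) * (\<Prod>i<t. x ^ r - x ^ i)" for t
    proof -
      have "(\<Prod>i<t. x ^ m - x ^ (k + i)) = (\<Prod>i<t. x ^ k * (x ^ r - x ^ i))"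
        by (simp add: m_eq power_add algebra_simps)
      then show ?thesis by (simp add: prod.distrib power_mult)
    qed
    then have "(\<Sum>t\<le>T. (-1) ^ t / (x ^ (k * t) * (\<Prod>l=1..t. x ^ l - 1)) *
            (\<Prod>i=1..<k + t. x ^ m - x ^ i)) =
          (\<Sum>t\<le>T. (\<Prod>i=1..<k. x ^ m - x ^ i) *
             ((-1) ^ t * (\<Prod>i<t. x ^ r - x ^ i) / (\<Prod>l=1..t. x ^ l - 1)))"
      using x by (intro sum.cong refl) (simp only: split, simp)
    also have "\<dots> = (\<Prod>i=1..<k. x ^ m - x ^ i) *
        ((-1) ^ T * (\<Prod>i=1..T. x ^ r - x ^ i) / (\<Prod>l=1..T. x ^ l - 1))"
      by (simp only: sum_distrib_left[symmetric] sum_telescoped_q_falling[OF x])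
    also have "\<dots> = (if m = k then \<Prod>i=1..<k. x ^ k - x ^ i else 0)"
    proof (cases "r = 0")
      case True
      have "(\<Prod>l=1..T. x ^ l - 1) \<noteq> 0"
        using prod_power_minus_one_pos[OF x, of T] by linarith
      moreover have "(\<Prod>i=1..T. 1 - x ^ i) = (\<Prod>i=1..T. (-1) * (x ^ i - 1))" by simp
      then have "(\<Prod>i=1..T. 1 - x ^ i) = (-1) ^ T * (\<Prod>i=1..T. x ^ i - 1)"
        by (simp only: prod.distrib) simp
      ultimately show ?thesis using True m_eq by simp
    next
      case False
      \<comment> \<open>The factor \<open>i = r\<close> occurs because \<open>m \<le> k + T\<close>
        gives \<open>r \<le> T\<close>.\<close>
      then have "(\<Prod>i=1..T. x ^ r - x ^ i) = 0" using m m_eq by (intro prod_zero) auto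
      then show ?thesis using False m_eq by simp
    qed
    finally show ?thesis .
  qed
qed

section \<open>Euler's product identity\<close>

text \<open>These numbers are both the inversion coefficients of \<open>q_inversion\<close> and the
  summands of the series \<open>F k\<close>; at \<open>i = 0\<close> the empty product gives
  \<open>1\<close>.\<close>

definition euler_term :: "real \<Rightarrow> nat \<Rightarrow> nat \<Rightarrow> real" where
  "euler_term x k i = (-1) ^ i / (x ^ (k * i) * (\<Prod>j=1..i. x ^ j - 1))"

lemma prod_power_minus_one_ge_1:
  fixes x :: real
  assumes "x \<ge> 2"
  shows "(\<Prod>j=1..i. x ^ j - 1) \<ge> 1"
proof (rule prod_ge_1)
  fix j assume "j \<in> {1..i}"
  then have "x ^ 1 \<le> x ^ j" using assms by (intro power_increasing) auto
  then show "1 \<le> x ^ j - 1" using assms by simp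
qed

text \<open>For \<open>x \<ge> 2\<close> every factor \<open>x ^ j - 1\<close> is at least
  \<open>1\<close>, so dropping these factors leaves a geometric majorant.\<close>

lemma abs_euler_term_le:
  assumes "x \<ge> 2"
  shows "\<bar>euler_term x k i\<bar> \<le> (1 / x ^ k) ^ i"
proof -
  have "x ^ (k * i) * 1 \<le> x ^ (k * i) * (\<Prod>j=1..i. x ^ j - 1)"
    using assms prod_power_minus_one_ge_1[OF assms, of i] by (intro mult_left_mono) auto
  moreover have "x ^ (k * i) > 0" using assms by simp
  ultimately have "1 / (x ^ (k * i) * (\<Prod>j=1..i. x ^ j - 1)) \<le> 1 / x ^ (k * i)"
    by (intro divide_left_mono) auto
  moreover have "(\<Prod>j=1..i. x ^ j - 1) \<ge> 0" using prod_power_minus_one_ge_1[OF assms, of i] by simp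
  ultimately show ?thesis
    using assms by (simp add: euler_term_def abs_mult power_abs power_mult power_divide)
qed

lemma inverse_power_le_half:
  fixes x :: real
  assumes "x \<ge> 2" "k \<ge> 1"
  shows "1 / x ^ k \<le> 1 / 2"
proof -
  have "x ^ 1 \<le> x ^ k" using assms by (intro power_increasing) auto
  then show ?thesis using assms by (intro divide_left_mono) auto
qed

lemma summable_euler_term:
  assumes "x \<ge> 2" "k \<ge> 1"
  shows "summable (euler_term x k)"
proof (rule summable_comparison_test'[where g = "\<lambda>i. (1 / x ^ k) ^ i" and N = 0])
  show "summable (\<lambda>i. (1 / x ^ k) ^ i)"
    using assms inverse_power_le_half[OF assms] by (intro summable_geometric) simp
qed (use abs_euler_term_le[OF assms(1)] in simp)

section \<open>Functional equation and limit of the series\<close>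

lemma euler_term_0 [simp]: "euler_term x k 0 = 1"
  by (simp add: euler_term_def)

text \<open>Multiply by \<open>1 = 1 / x ^ (i+1) + (x ^ (i+1) - 1) / x ^ (i+1)\<close>. The first
  part raises \<open>k\<close> to \<open>k + 1\<close>; the second cancels the last factor of the
  product and so lowers the index.\<close>

lemma euler_term_Suc_diff:
  assumes "x \<ge> 2"
  shows "euler_term x k (Suc i) = euler_term x (Suc k) (Suc i) - 1 / x ^ Suc k * euler_term x (Suc k) i"
proof -
  let ?D = "\<Prod>j=1..i. x ^ j - 1"
  have D: "?D \<noteq> 0" using prod_power_minus_one_ge_1[OF assms, of i] by linarith
  have y: "x ^ Suc i - 1 \<noteq> 0"
    using one_less_power[of x "Suc i"] assms by linarith
  have x: "x \<noteq> 0" using assms by simp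
  have e2: "x ^ (Suc k * Suc i) = x ^ (k * Suc i) * x ^ Suc i"
    by (simp only: mult_Suc power_add mult.commute[of "x ^ Suc i"])
  have "Suc k + Suc k * i = k * Suc i + Suc i" by simp
  then have e3: "x ^ Suc k * x ^ (Suc k * i) = x ^ (k * Suc i) * x ^ Suc i"
    by (simp only: power_add[symmetric])
  have prod: "(\<Prod>j=1..Suc i. x ^ j - 1) = ?D * (x ^ Suc i - 1)" by simp
  have 1: "euler_term x k (Suc i) = - ((-1) ^ i) / (x ^ (k * Suc i) * (?D * (x ^ Suc i - 1)))"
    unfolding euler_term_def prod by simp
  have 2: "euler_term x (Suc k) (Suc i) = - ((-1) ^ i) / (x ^ (k * Suc i) * x ^ Suc i * (?D * (x ^ Suc i - 1)))"
    unfolding euler_term_def prod e2 by simp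
  have 3: "1 / x ^ Suc k * euler_term x (Suc k) i = (-1) ^ i / (x ^ (k * Suc i) * x ^ Suc i * ?D)"
    unfolding euler_term_def e3[symmetric] by (simp only: times_divide_times_eq mult_1 mult.assoc)
  have "- s / (a * (d * e)) = - s / (a * (e + 1) * (d * e)) - s / (a * (e + 1) * d)"
    if "a \<noteq> 0" "e + 1 \<noteq> 0" "d \<noteq> 0" "e \<noteq> 0" for s a d e :: real
    using that by (simp add: divide_simps) (simp add: algebra_simps)
  from this[of "x ^ (k * Suc i)" "x ^ Suc i - 1" ?D "(-1) ^ i"] show ?thesis
    unfolding 1 2 3 diff_add_cancel using x D y by (simp only: power_not_zero not_False_eq_True simp_thms)
qed

text \<open>The termwise difference is summed over \<open>i\<close>; the head terms of the two
  series both equal \<open>1\<close> and cancel.\<close>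

lemma suminf_euler_term_Suc:
  assumes "x \<ge> 2" "k \<ge> 1"
  shows "suminf (euler_term x k) = (1 - 1 / x ^ Suc k) * suminf (euler_term x (Suc k))"
proof -
  have s: "summable (euler_term x k)" "summable (euler_term x (Suc k))"
    using assms by (auto intro: summable_euler_term)
  have "suminf (euler_term x k) = 1 + (\<Sum>i. euler_term x k (Suc i))"
    using suminf_split_head[OF s(1)] by simp
  also have "\<dots> = 1 + ((\<Sum>i. euler_term x (Suc k) (Suc i)) - (\<Sum>i. 1 / x ^ Suc k * euler_term x (Suc k) i))"
    using suminf_diff[OF summable_Suc_iff[THEN iffD2, OF s(2)] summable_mult[OF s(2), of "1 / x ^ Suc k"]]
    by (simp only: euler_term_Suc_diff[OF assms(1), of k])
  also have "(\<Sum>i. 1 / x ^ Suc k * euler_term x (Suc k) i) = 1 / x ^ Suc k * suminf (euler_term x (Suc k))"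
    using s(2) by (rule suminf_mult)
  also have "(\<Sum>i. euler_term x (Suc k) (Suc i)) = suminf (euler_term x (Suc k)) - 1"
    using suminf_split_head[OF s(2)] by simp
  finally show ?thesis by (simp add: algebra_simps)
qed

text \<open>Beyond the head term \<open>1\<close> the series is dominated by a geometric one with
  ratio \<open>p \<le> 1 / 2\<close>, whose sum from exponent \<open>1\<close> on is at most
  \<open>2 * p\<close>.\<close>

lemma suminf_euler_term_tendsto:
  assumes "x \<ge> 2"
  shows "(\<lambda>k. suminf (euler_term x k)) \<longlonglongrightarrow> 1"
proof (rule LIMSEQ_offset[where k = 1])
  \<comment> \<open>At \<open>k = 0\<close> the geometric majorant has ratio \<open>1\<close>, so
    the index starts at \<open>1\<close>.\<close>
  have bound: "\<bar>suminf (euler_term x (k + 1)) - 1\<bar> \<le> 2 * (1 / x) ^ (k + 1)" for k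
  proof -
    let ?p = "1 / x ^ (k + 1)"
    have p: "0 < ?p" "?p \<le> 1 / 2" using assms inverse_power_le_half[of x "k + 1"] by auto
    have s: "summable (euler_term x (k + 1))" using assms by (intro summable_euler_term) auto
    have g: "summable (\<lambda>i. ?p ^ Suc i)"
      using p by (subst summable_Suc_iff) (intro summable_geometric, simp)
    have abs: "summable (\<lambda>i. \<bar>euler_term x (k + 1) (Suc i)\<bar>)"
      by (rule summable_comparison_test'[OF g, where N = 0])
        (simp only: real_norm_def abs_abs abs_euler_term_le[OF assms])
    have "\<bar>suminf (euler_term x (k + 1)) - 1\<bar> = \<bar>\<Sum>i. euler_term x (k + 1) (Suc i)\<bar>"
      using suminf_split_head[OF s] by simp
    also have "\<dots> \<le> (\<Sum>i. \<bar>euler_term x (k + 1) (Suc i)\<bar>)"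
      by (rule summable_rabs[OF abs])
    also have "\<dots> \<le> (\<Sum>i. ?p ^ Suc i)"
      by (rule suminf_le[OF abs_euler_term_le[OF assms] abs g])
    also have "\<dots> = ?p * (1 / (1 - ?p))"
    proof -
      have n: "norm ?p < 1" using p by simp
      show ?thesis
        using suminf_mult[OF summable_geometric[OF n], of ?p]
        by (simp only: power_Suc suminf_geometric[OF n])
    qed
    also have "\<dots> \<le> ?p * 2"
    proof (rule mult_left_mono)
      have "1 / (1 - ?p) \<le> 1 / (1 / 2)" using p by (intro divide_left_mono) simp_all
      then show "1 / (1 - ?p) \<le> 2" by simp
    qed (use p in linarith)
    finally show ?thesis by (simp add: power_divide mult.commute)
  qed
  have "(\<lambda>k. (1 / x) ^ (k + 1)) \<longlonglongrightarrow> 0"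
    by (rule LIMSEQ_ignore_initial_segment[OF LIMSEQ_power_zero]) (use assms in simp)
  then have lim: "(\<lambda>k. 2 * (1 / x) ^ (k + 1)) \<longlonglongrightarrow> 0" by (rule tendsto_mult_right_zero)
  have "(\<lambda>k. suminf (euler_term x (k + 1)) - 1) \<longlonglongrightarrow> 0"
    by (rule Lim_null_comparison[OF _ lim]) (use bound in simp)
  then show "(\<lambda>k. suminf (euler_term x (k + 1))) \<longlonglongrightarrow> 1"
    by (simp add: LIM_zero_iff)
qed

text \<open>By the functional equation the left side has the same value for every
  \<open>k \<ge> 1\<close>; its limit as \<open>k\<close> grows is the infinite product, since the
  series tends to \<open>1\<close>.\<close>

lemma suminf_euler_term:
  fixes x :: real
  assumes x: "x \<ge> 2" and k: "k \<ge> 1"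
  shows "suminf (euler_term x k) * (\<Prod>r=1..k. 1 - 1 / x ^ r) = (\<Prod>r. 1 - 1 / x ^ (r + 1))"
proof -
  let ?f = "\<lambda>r. 1 - 1 / x ^ (r + 1)"
  have iter: "suminf (euler_term x k) * (\<Prod>r=1..k. 1 - 1 / x ^ r) =
      suminf (euler_term x (k + M)) * (\<Prod>r=1..k + M. 1 - 1 / x ^ r)" for M
  proof (induction M)
    case (Suc M)
    have "suminf (euler_term x (k + M)) = (1 - 1 / x ^ Suc (k + M)) * suminf (euler_term x (k + Suc M))"
      using suminf_euler_term_Suc[OF x, of "k + M"] k by simp
    moreover have "(\<Prod>r=1..k + Suc M. 1 - 1 / x ^ r) =
        (\<Prod>r=1..k + M. 1 - 1 / x ^ r) * (1 - 1 / x ^ Suc (k + M))" by simp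
    ultimately show ?case unfolding Suc.IH by (simp only: ac_simps)
  qed simp
  have "summable (\<lambda>r. norm (?f r - 1))"
  proof -
    have "summable (\<lambda>r. (1 / x) ^ Suc r)"
      using x by (subst summable_Suc_iff) (intro summable_geometric, simp)
    then show ?thesis using x by (simp add: power_divide)
  qed
  then have "convergent_prod ?f"
    by (intro abs_convergent_prod_imp_convergent_prod summable_imp_abs_convergent_prod)
  then have "(\<lambda>n. prod ?f {..n}) \<longlonglongrightarrow> prodinf ?f" by (rule convergent_prod_LIMSEQ)
  \<comment> \<open>\<open>prod ?f {..n}\<close> has \<open>n + 1\<close> factors, which is the
    offset removed afterwards.\<close>
  also have "(\<lambda>n. prod ?f {..n}) = (\<lambda>n. \<Prod>r=1..n + 1. 1 - 1 / x ^ r)"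
    by (rule ext, rule prod.reindex_bij_witness[of _ "\<lambda>i. i - 1" "\<lambda>i. i + 1"]) auto
  finally have "(\<lambda>n. \<Prod>r=1..n. 1 - 1 / x ^ r) \<longlonglongrightarrow> prodinf ?f"
    by (rule LIMSEQ_offset[where k = 1])
  from tendsto_mult[OF suminf_euler_term_tendsto[OF x] this]
  have "(\<lambda>n. suminf (euler_term x n) * (\<Prod>r=1..n. 1 - 1 / x ^ r)) \<longlonglongrightarrow> prodinf ?f" by simp
  then have "(\<lambda>M. suminf (euler_term x (M + k)) * (\<Prod>r=1..M + k. 1 - 1 / x ^ r)) \<longlonglongrightarrow> prodinf ?f"
    by (rule LIMSEQ_ignore_initial_segment)
  moreover have "(\<lambda>M. suminf (euler_term x (M + k)) * (\<Prod>r=1..M + k. 1 - 1 / x ^ r)) =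
      (\<lambda>_. suminf (euler_term x k) * (\<Prod>r=1..k. 1 - 1 / x ^ r))"
    by (rule ext) (metis iter add.commute)
  ultimately have "(\<lambda>_::nat. suminf (euler_term x k) * (\<Prod>r=1..k. 1 - 1 / x ^ r)) \<longlonglongrightarrow> prodinf ?f"
    by (simp only:)
  then show ?thesis by (rule LIMSEQ_const_iff[THEN iffD1])
qed

section \<open>Fixed spaces in the affine group\<close>

text \<open>The column condition says that the first unit vector is fixed. The one-element list puts
  the group in the form required by \<open>card_pointwise_stabilizer\<close>.\<close>

lemma A_grp_eq_stabilizer:
  "A_grp n = {A \<in> carrier_mat (n + 1) (n + 1). invertible_mat A \<and>
     (\<forall>v\<in>set [unit_vec (n + 1) 0]. A *\<^sub>v v = v)}"
proof -
  have "A *\<^sub>v unit_vec (n + 1) 0 = unit_vec (n + 1) 0 \<longleftrightarrow>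
      A $$ (0, 0) = 1 \<and> (\<forall>j. 1 \<le> j \<and> j \<le> n \<longrightarrow> A $$ (j, 0) = 0)"
    if A: "A \<in> carrier_mat (n + 1) (n + 1)" for A :: "'a mat"
  proof -
    have "A *\<^sub>v unit_vec (n + 1) 0 = col A 0" using A by (intro mult_mat_vec_unit_vec) auto
    moreover have "col A 0 = unit_vec (n + 1) 0 \<longleftrightarrow> (\<forall>j<n + 1. A $$ (j, 0) = (if j = 0 then 1 else 0))"
      using A by (auto simp: vec_eq_iff unit_vec_def)
    moreover have "\<dots> \<longleftrightarrow> A $$ (0, 0) = 1 \<and> (\<forall>j. 1 \<le> j \<and> j \<le> n \<longrightarrow> A $$ (j, 0) = 0)"
      by (auto simp: less_Suc_eq_le)
    ultimately show ?thesis by simp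
  qed
  then show ?thesis unfolding A_grp_def by auto
qed

lemma list_indep_unit_vec: "i < n \<Longrightarrow> list_indep n [unit_vec n i]"
  by (auto simp: vec_eq_iff)

text \<open>With a factor \<open>q\<close> taken out of each term, the order becomes
  \<open>q^n |GL(n,q)|\<close>.\<close>

lemma finite_A_grp: "finite (A_grp n)"
  and card_A_grp: "card (A_grp n :: 'a::{finite,field} mat set) = (\<Prod>i=1..<n + 1. CARD('a) ^ (n + 1) - CARD('a) ^ i)"
  using card_pointwise_stabilizer[OF list_indep_unit_vec[of 0 "n + 1"]]
  unfolding A_grp_eq_stabilizer by simp_all

lemma mat_kernel_minus_one:
  fixes A :: "'a::field mat"
  assumes A: "A \<in> carrier_mat n n"
  shows "mat_kernel (A - 1\<^sub>m n) = {v \<in> carrier_vec n. A *\<^sub>v v = v}"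
proof -
  have "(A - 1\<^sub>m n) *\<^sub>v v = 0\<^sub>v n \<longleftrightarrow> A *\<^sub>v v = v" if v: "v \<in> carrier_vec n" for v
  proof -
    have "(A - 1\<^sub>m n) *\<^sub>v v = A *\<^sub>v v - v"
      using minus_mult_distrib_mat_vec[OF A one_carrier_mat v] v by simp
    moreover have "A *\<^sub>v v \<in> carrier_vec n" using A v by simp
    moreover have "x - v = 0\<^sub>v n \<longleftrightarrow> x = v" if "x \<in> carrier_vec n" for x
      using that v by (auto simp: vec_eq_iff)
    ultimately show ?thesis by simp
  qed
  moreover have "A - 1\<^sub>m n \<in> carrier_mat n n" using A by auto
  ultimately show ?thesis using mat_kernel[of "A - 1\<^sub>m n" n n] by auto
qed

text \<open>The fixed space is the kernel of \<open>A - 1\<close>. All later counting sees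
  \<open>fixed_dim\<close> only through this cardinality.\<close>

lemma card_fixed_space:
  fixes A :: "'a::{finite,field} mat"
  assumes A: "A \<in> carrier_mat n n"
  shows "card {v \<in> carrier_vec n. A *\<^sub>v v = v} = CARD('a) ^ fixed_dim A"
  using card_mat_kernel[of "A - 1\<^sub>m n" n n, OF minus_carrier_mat[OF one_carrier_mat]] A
  by (simp add: fixed_dim_def mat_kernel_minus_one)

lemma vec_subspace_fixed_space:
  assumes A: "A \<in> carrier_mat n n"
  shows "vec_subspace n {v \<in> carrier_vec n. A *\<^sub>v v = v}"
  using vec_subspace_mat_kernel[of "A - 1\<^sub>m n" n n, OF minus_carrier_mat[OF one_carrier_mat]] A
  by (simp add: mat_kernel_minus_one)

text \<open>The fixed space contains zero and the first unit vector, hence has more than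
  \<open>q^0\<close> elements. The two bounds are what \<open>q_inversion\<close> demands of
  \<open>m\<close>.\<close>

lemma fixed_dim_A_grp:
  fixes A :: "'a::{finite,field} mat"
  assumes "A \<in> A_grp n"
  shows "1 \<le> fixed_dim A" "fixed_dim A \<le> n + 1"
proof -
  let ?W = "{v \<in> carrier_vec (n + 1). A *\<^sub>v v = v}" and ?e = "unit_vec (n + 1) 0 :: 'a vec"
  have A: "A \<in> carrier_mat (n + 1) (n + 1)" and e: "A *\<^sub>v ?e = ?e"
    using assms by (auto simp: A_grp_eq_stabilizer)
  have finW: "finite ?W" using vec_subspace_fixed_space[OF A] by (rule finite_vec_subspace)
  have "{0\<^sub>v (n + 1), ?e} \<subseteq> ?W"
    using vec_subspace_fixed_space[OF A] e by (simp add: vec_subspace_def)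
  moreover have "?e \<noteq> 0\<^sub>v (n + 1)" by (simp add: vec_eq_iff)
  then have "card {0\<^sub>v (n + 1), ?e} = 2" unfolding card_2_iff by blast
  ultimately have "2 \<le> CARD('a) ^ fixed_dim A"
    using card_mono[OF finW] card_fixed_space[OF A] by metis
  then show "1 \<le> fixed_dim A" by (cases "fixed_dim A") auto
  have "card ?W \<le> card (carrier_vec (n + 1) :: 'a vec set)"
    by (intro card_mono finite_carrier_vec) auto
  then have "CARD('a) ^ fixed_dim A \<le> CARD('a) ^ (n + 1)"
    unfolding card_fixed_space[OF A] card_carrier_vec .
  then show "fixed_dim A \<le> n + 1" by (rule power_le_imp_le_exp[OF one_less_CARD_field])
qed

text \<open>Pairs of a group element and a frame of length \<open>j\<close> fixed by it are counted
  in two ways. Grouped by frame, each contributes a stabilizer of the same order, and this order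
  times the number of frames is the order of the group.\<close>

lemma sum_fixed_frames:
  assumes "j \<le> n"
  shows "(\<Sum>A\<in>(A_grp n :: 'a::{finite,field} mat set).
            \<Prod>i=1..<j + 1. CARD('a) ^ fixed_dim A - CARD('a) ^ i) = card (A_grp n :: 'a mat set)"
proof -
  let ?q = "CARD('a)" and ?N = "n + 1" and ?e = "unit_vec (n + 1) 0 :: 'a vec"
  \<comment> \<open>With the unit vector as tail, the exponents in the count start at
    \<open>1\<close>.\<close>
  let ?F = "\<lambda>W. {us. length us = j \<and> set us \<subseteq> W \<and> list_indep ?N (us @ [?e])}"
  let ?T = "?F (carrier_vec ?N)"
  let ?G = "A_grp n :: 'a mat set"
  let ?R = "\<lambda>A us. \<forall>u\<in>set us. A *\<^sub>v u = u"
  have e: "list_indep ?N [?e]" by (rule list_indep_unit_vec) simp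
  have finT: "finite ?T"
    by (rule finite_subset[OF _ finite_lists_length_eq[OF finite_carrier_vec[of ?N], of j]]) auto
  have card_fixed: "card {us \<in> ?T. ?R A us} = (\<Prod>i=1..<j + 1. ?q ^ fixed_dim A - ?q ^ i)"
    if "A \<in> ?G" for A
  proof -
    have A: "A \<in> carrier_mat ?N ?N" and Ae: "A *\<^sub>v ?e = ?e"
      using that by (auto simp: A_grp_eq_stabilizer)
    let ?W = "{v \<in> carrier_vec ?N. A *\<^sub>v v = v}"
    have "{us \<in> ?T. ?R A us} = ?F ?W" by auto
    then show ?thesis
      using card_list_indep_extensions[OF vec_subspace_fixed_space[OF A] card_fixed_space[OF A] e, of j] Ae
      by (simp add: add.commute)
  qed
  have card_stab: "card {A \<in> ?G. ?R A us} = (\<Prod>i=j + 1..<?N. ?q ^ ?N - ?q ^ i)" if us: "us \<in> ?T" for us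
  proof -
    have "{A \<in> ?G. ?R A us} = {A \<in> carrier_mat ?N ?N. invertible_mat A \<and> (\<forall>v\<in>set (us @ [?e]). A *\<^sub>v v = v)}"
      by (auto simp: A_grp_eq_stabilizer)
    then show ?thesis using card_pointwise_stabilizer(2)[of ?N "us @ [?e]"] us by simp
  qed
  have card_T: "card ?T = (\<Prod>i=1..<j + 1. ?q ^ ?N - ?q ^ i)"
    using card_list_indep_extensions[OF vec_subspace_carrier card_carrier_vec e, of j]
    by (simp add: add.commute)
  have "(\<Sum>A\<in>?G. \<Prod>i=1..<j + 1. ?q ^ fixed_dim A - ?q ^ i) = (\<Sum>A\<in>?G. \<Sum>us | us \<in> ?T \<and> ?R A us. 1)"
    using card_fixed by (intro sum.cong refl) simp
  also have "\<dots> = (\<Sum>us\<in>?T. \<Sum>A | A \<in> ?G \<and> ?R A us. 1)"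
    by (rule sum.swap_restrict[OF finite_A_grp finT])
  also have "\<dots> = (\<Sum>us\<in>?T. \<Prod>i=j + 1..<?N. ?q ^ ?N - ?q ^ i)"
    using card_stab by (intro sum.cong refl) simp
  also have "\<dots> = (\<Prod>i=1..<j + 1. ?q ^ ?N - ?q ^ i) * (\<Prod>i=j + 1..<?N. ?q ^ ?N - ?q ^ i)"
    by (simp only: sum_constant card_T of_nat_id)
  \<comment> \<open>Frames use the exponents \<open>1\<close> to \<open>j\<close>, stabilizers
    \<open>j + 1\<close> to \<open>n\<close>; together they give the group order.\<close>
  also have "\<dots> = (\<Prod>i=1..<?N. ?q ^ ?N - ?q ^ i)"
    using assms by (intro prod.atLeastLessThan_concat) auto
  finally show ?thesis unfolding card_A_grp .
qed

section \<open>From the moments to the distribution\<close>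

text \<open>If a factor on the left is truncated, then both products contain a zero factor.\<close>

lemma of_nat_prod_power_diff:
  fixes q :: nat
  assumes q: "q \<ge> 1" and d: "d \<ge> 1"
  shows "real (\<Prod>i=1..<m. q ^ d - q ^ i) = (\<Prod>i=1..<m. real q ^ d - real q ^ i)"
proof (cases "d < m")
  case True
  then have "(\<Prod>i=1..<m. q ^ d - q ^ i) = 0" "(\<Prod>i=1..<m. real q ^ d - real q ^ i) = 0"
    using d by (auto intro!: prod_zero bexI[of _ d])
  then show ?thesis by (simp only: of_nat_0)
next
  case False
  have "real (q ^ d - q ^ i) = real q ^ d - real q ^ i" if "i \<in> {1..<m}" for i
  proof -
    have "q ^ i \<le> q ^ d" using that False q by (intro power_increasing) auto
    then show ?thesis by (simp add: of_nat_diff)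
  qed
  then show ?thesis unfolding of_nat_prod by (rule prod.cong[OF refl])
qed

text \<open>This is the diagonal value in \<open>q_inversion\<close>, the source of the factor
  \<open>1 / |A(k-1,q)|\<close>.\<close>

lemma real_card_A_grp:
  assumes "k \<ge> 1"
  shows "real (card (A_grp (k - 1) :: 'a::{finite,field} mat set)) =
           (\<Prod>i=1..<k. real CARD('a) ^ k - real CARD('a) ^ i)"
  using assms of_nat_prod_power_diff[of "CARD('a)" k k] by (simp add: card_A_grp)

lemma real_card_A_grp_pos: "real (card (A_grp n :: 'a::{finite,field} mat set)) > 0"
proof -
  have "1\<^sub>m (n + 1) \<in> (A_grp n :: 'a mat set)"
    by (auto simp: A_grp_def invertible_mat_inverse[of _ "n + 1"] intro!: bexI[of _ "1\<^sub>m (n + 1)"])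
  then show ?thesis using finite_A_grp card_gt_0_iff of_nat_0_less_iff by blast
qed

text \<open>\<open>q_inversion\<close> writes the indicator of \<open>fixed_dim A = k\<close>,
  scaled by the order of \<open>A(k-1,q)\<close>, as a combination of frame counts. Each frame count
  has mean \<open>1\<close>, so only the sum of the coefficients remains.\<close>

lemma P_A_eq:
  assumes k: "k \<ge> 1"
  shows "P_A TYPE('a::{finite,field}) n k = 1 / real (card (A_grp (k - 1) :: 'a mat set)) *
           (\<Sum>i | k + i \<le> n + 1. euler_term (real CARD('a)) k i)"
proof (cases "k \<le> n + 1")
  case False
  \<comment> \<open>For \<open>k > n + 1\<close> no element qualifies and the index set is empty;
    the form \<open>k + i \<le> n + 1\<close> of the condition avoids truncated subtraction.\<close>
  then have "{x \<in> (A_grp n :: 'a mat set). fixed_dim x = k} = {}" using fixed_dim_A_grp(2) by force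
  moreover have "{i. k + i \<le> n + 1} = {}" using False by auto
  ultimately show ?thesis unfolding P_A_def by (simp only: card.empty sum.empty of_nat_0 div_0 mult_zero_right)
next
  case True
  \<comment> \<open>The choice meets two demands: frames of length \<open>k + t - 1\<close> with
    \<open>t \<le> T\<close> have length at most \<open>n\<close>, and \<open>k + T = n + 1\<close>
    bounds every fixed dimension.\<close>
  define T where "T = n + 1 - k"
  let ?q = "real CARD('a)" and ?G = "A_grp n :: 'a mat set" and ?c = "euler_term (real CARD('a)) k"
  let ?D = "real (card (A_grp (k - 1) :: 'a mat set))"
  have q1: "?q > 1" using one_less_CARD_field[where 'a='a] by simp
  have index: "{i. k + i \<le> n + 1} = {..T}" using True by (auto simp: T_def)
  have moment: "(\<Sum>A\<in>?G. \<Prod>i=1..<k + t. ?q ^ fixed_dim A - ?q ^ i) = real (card ?G)" if t: "t \<le> T" for t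
  proof -
    have "(\<Sum>A\<in>?G. \<Prod>i=1..<k + t. ?q ^ fixed_dim A - ?q ^ i) =
        real (\<Sum>A\<in>?G. \<Prod>i=1..<k + t. CARD('a) ^ fixed_dim A - CARD('a) ^ i)"
      unfolding of_nat_sum
    proof (rule sum.cong[OF refl])
      fix A assume "A \<in> ?G"
      from of_nat_prod_power_diff[OF less_imp_le[OF one_less_CARD_field[where 'a='a]]
          fixed_dim_A_grp(1)[OF this], of "k + t"]
      show "(\<Prod>i=1..<k + t. ?q ^ fixed_dim A - ?q ^ i) =
          real (\<Prod>i=1..<k + t. CARD('a) ^ fixed_dim A - CARD('a) ^ i)" ..
    qed
    moreover have "k + t - 1 + 1 = k + t" "k + t - 1 \<le> n" using k t True by (simp_all add: T_def)
    ultimately show ?thesis using sum_fixed_frames[of "k + t - 1" n, where 'a='a] by (simp only:)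
  qed
  have "real (card {x \<in> ?G. fixed_dim x = k}) * ?D = (\<Sum>A\<in>?G. if fixed_dim A = k then ?D else 0)"
    by (simp only: sum.inter_filter[OF finite_A_grp, symmetric] sum_constant)
  also have "\<dots> = (\<Sum>A\<in>?G. \<Sum>t\<le>T. ?c t * (\<Prod>i=1..<k + t. ?q ^ fixed_dim A - ?q ^ i))"
  proof (rule sum.cong[OF refl])
    fix A assume A: "A \<in> ?G"
    have "fixed_dim A \<le> k + T" using fixed_dim_A_grp(2)[OF A] True by (simp add: T_def)
    from q_inversion[OF q1 k fixed_dim_A_grp(1)[OF A] this]
    show "(if fixed_dim A = k then ?D else 0) =
        (\<Sum>t\<le>T. ?c t * (\<Prod>i=1..<k + t. ?q ^ fixed_dim A - ?q ^ i))"
      unfolding euler_term_def real_card_A_grp[OF k] by simp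
  qed
  also have "\<dots> = (\<Sum>t\<le>T. ?c t * (\<Sum>A\<in>?G. \<Prod>i=1..<k + t. ?q ^ fixed_dim A - ?q ^ i))"
    unfolding sum_distrib_left by (rule sum.swap)
  also have "\<dots> = (\<Sum>t\<le>T. ?c t * real (card ?G))"
    by (rule sum.cong[OF refl]) (simp only: moment atMost_iff)
  also have "\<dots> = (\<Sum>t\<le>T. ?c t) * real (card ?G)" by (rule sum_distrib_right[symmetric])
  finally show ?thesis
    unfolding P_A_def index
    using real_card_A_grp_pos[where 'a='a, of n] real_card_A_grp_pos[where 'a='a, of "k - 1"]
    by (simp add: field_simps)
qed

text \<open>Reverse the product by \<open>i = k - j\<close> and take \<open>q^k\<close> out of each
  of the \<open>k - 1\<close> factors.\<close>

lemma real_card_A_grp_eq_power: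
  assumes k: "k \<ge> 1" and q: "q = CARD('a::{finite,field})"
  shows "real (card (A_grp (k - 1) :: 'a mat set)) =
           real q ^ (k\<^sup>2 - k) * (\<Prod>j=1..k - 1. 1 - 1 / real q ^ j)"
proof -
  have q0: "real q > 0" using one_less_CARD_field[where 'a='a] q by simp
  have "real (card (A_grp (k - 1) :: 'a mat set)) = (\<Prod>i=1..<k. real q ^ k - real q ^ i)"
    unfolding real_card_A_grp[OF k] q ..
  also have "\<dots> = (\<Prod>j=1..k - 1. real q ^ k * (1 - 1 / real q ^ j))"
  proof (rule prod.reindex_bij_witness[of _ "\<lambda>j. k - j" "\<lambda>i. k - i"])
    fix i assume i: "i \<in> {1..<k}"
    have "real q ^ k = real q ^ i * real q ^ (k - i)" using i by (simp flip: power_add)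
    then show "real q ^ k * (1 - 1 / real q ^ (k - i)) = real q ^ k - real q ^ i"
      using q0 by (simp add: right_diff_distrib)
  qed (use k in auto)
  also have "\<dots> = (real q ^ k) ^ (k - 1) * (\<Prod>j=1..k - 1. 1 - 1 / real q ^ j)"
    by (simp add: prod.distrib)
  also have "(real q ^ k) ^ (k - 1) = real q ^ (k\<^sup>2 - k)"
    by (simp add: power2_eq_square diff_mult_distrib2 flip: power_mult)
  finally show ?thesis .
qed

theorem theorem4p4:
  fixes q :: nat and k :: nat
  assumes "q = CARD('a::{finite,field})" and "k \<ge> 1"
  shows "(\<forall>n. P_A TYPE('a) n k =
            1 / real (card (A_grp (k - 1) :: 'a mat set)) *
            (\<Sum>i | k + i \<le> n + 1.
               (-1) ^ i / (real q ^ (k * i) * (\<Prod>j = 1..i. (real q ^ j - 1)))))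
       \<and> ((\<lambda>n. P_A TYPE('a) n k) \<longlonglongrightarrow>
            (\<Prod>r. 1 - 1 / real q ^ (r + 1)) *
            ((1 / real q) ^ (k^2 - k) /
             ((\<Prod>j = 1..k - 1. (1 - 1 / real q ^ j)^2) * (1 - 1 / real q ^ k))))"
proof
  show "\<forall>n. P_A TYPE('a) n k =
            1 / real (card (A_grp (k - 1) :: 'a mat set)) *
            (\<Sum>i | k + i \<le> n + 1.
               (-1) ^ i / (real q ^ (k * i) * (\<Prod>j = 1..i. (real q ^ j - 1))))"
    using P_A_eq[OF assms(2), where 'a='a] unfolding assms(1) euler_term_def by blast
next
  let ?C = "real (card (A_grp (k - 1) :: 'a mat set))"
  let ?\<Pi> = "\<Prod>r. 1 - 1 / real q ^ (r + 1)" and ?E = "\<Prod>j=1..k - 1. 1 - 1 / real q ^ j"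
  have q2: "real q \<ge> 2" using one_less_CARD_field[where 'a='a] assms(1) by simp
  have pos: "1 - 1 / real q ^ j > 0" if "j \<ge> 1" for j
    using inverse_power_le_half[OF q2 that] by simp
  have E: "?E > 0" by (rule prod_pos) (use pos in auto)
  have F: "1 - 1 / real q ^ k > 0" using pos[OF assms(2)] .
  have "{1..k} = insert k {1..k - 1}" using assms(2) by auto
  then have "(\<Prod>r=1..k. 1 - 1 / real q ^ r) = (1 - 1 / real q ^ k) * ?E" using assms(2) by simp
  with suminf_euler_term[OF q2 assms(2)]
  have S: "suminf (euler_term (real q) k) * ((1 - 1 / real q ^ k) * ?E) = ?\<Pi>" by (simp only:)
  have "(\<lambda>n. P_A TYPE('a) n k) \<longlonglongrightarrow> 1 / ?C * suminf (euler_term (real q) k)"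
  \<comment> \<open>Shifting \<open>n\<close> by \<open>k - 1\<close> turns the index condition into
    \<open>i \<le> n\<close>, so the probabilities become scaled partial sums of the series.\<close>
  proof (rule LIMSEQ_offset[where k = "k - 1"])
    have "P_A TYPE('a) (n + (k - 1)) k = 1 / ?C * (\<Sum>i\<le>n. euler_term (real q) k i)" for n
    proof -
      have "{i. k + i \<le> n + (k - 1) + 1} = {..n}" using assms(2) by auto
      then show ?thesis
        using P_A_eq[OF assms(2), where 'a='a, of "n + (k - 1)"] by (simp only: assms(1))
    qed
    moreover have "(\<lambda>n. 1 / ?C * (\<Sum>i\<le>n. euler_term (real q) k i)) \<longlonglongrightarrow> 1 / ?C * suminf (euler_term (real q) k)"
      by (rule tendsto_mult_left[OF summable_LIMSEQ'[OF summable_euler_term[OF q2 assms(2)]]])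
    ultimately show "(\<lambda>n. P_A TYPE('a) (n + (k - 1)) k) \<longlonglongrightarrow> 1 / ?C * suminf (euler_term (real q) k)"
      by (simp only:)
  qed
  also have "1 / ?C * suminf (euler_term (real q) k) =
      ?\<Pi> * ((1 / real q) ^ (k^2 - k) / ((\<Prod>j = 1..k - 1. (1 - 1 / real q ^ j)^2) * (1 - 1 / real q ^ k)))"
  proof -
    \<comment> \<open>Here \<open>b\<close> is the power of \<open>q\<close>, \<open>e\<close> is
      \<open>?E\<close> and \<open>f\<close> the factor at \<open>k\<close>. One \<open>?E\<close>
      comes from the group order and one from Euler's product, hence the squares, while
      \<open>f\<close> comes from Euler's product alone.\<close>
    have "1 / (b * e) * s = s * (f * e) * (1 / b / (e\<^sup>2 * f))" if "e > 0" "f > 0" for b e f s :: real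
      using that by (simp add: power2_eq_square)
    from this[OF E F] show ?thesis
      unfolding real_card_A_grp_eq_power[OF assms(2,1)] prod_power_distrib S[symmetric] power_divide power_one .
  qed
  finally show "(\<lambda>n. P_A TYPE('a) n k) \<longlonglongrightarrow>
      ?\<Pi> * ((1 / real q) ^ (k^2 - k) / ((\<Prod>j = 1..k - 1. (1 - 1 / real q ^ j)^2) * (1 - 1 / real q ^ k)))" .
qed

end
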